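(* Let $d\ge1$, let $X=(\mathbb Z^d,\mathbb E^d)$ be the Euclidean lattice with the translation action of $G=\mathbb Z^d$, and let $S=\{0,1\}$ with base state $0$ and $\phi(s_1,s_2)=(s_2,s_1)$ (the exclusion process). Let $\omega=(\omega_e)\in\prod_{e\in\mathbb E^d}C_{\mathrm{loc}}(\{0,1\}^{\mathbb Z^d})$ be a shift-invariant closed form. Then there exist constants $a_1,\dots,a_d\in\mathbb R$ and a local function $f\in C_{\mathrm{loc}}(\{0,1\}^{\mathbb Z^d})$ satisfying $f(\star)=0$ such that $$\omega_e=\nabla_e\Bigl(\sum_{x\in\mathbb Z^d}\tau_x(f)+\sum_{j=1}^d a_j\sum_{x\in\mathbb Z^d}x_j\,\xi_x\Bigr)$$ in $C_{\mathrm{loc}}(\{0,1\}^{\mathbb Z^d})$ for any $e\in\mathbb E^d$, where $\xi_x(\eta)=\eta_x$.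
   Context: $\mathbb E^d=\{(x,y)\in\mathbb Z^d\times\mathbb Z^d:\sum_{j=1}^d|x_j-y_j|=1\}$. For $e=(o(e),t(e))\in\mathbb E^d$ and $\eta\in\{0,1\}^{\mathbb Z^d}$, $\eta^e$ is obtained from $\eta$ by exchanging the components at $o(e)$ and $t(e)$. $\star$ is the configuration with all components $0$. $\{0,1\}^{\mathbb Z^d}_*$ is the set of configurations with only finitely many nonzero components; $\Phi_*=\{(\eta,\eta^e):\eta\in\{0,1\}^{\mathbb Z^d}_*,\ e\in\mathbb E^d\}$ makes it a symmetric directed graph. A function is local if it depends only on the components of $\eta$ in some finite $\Lambda\subset\mathbb Z^d$; $C_{\mathrm{loc}}(\{0,1\}^{\mathbb Z^d})$ is the space of local real-valued functions, regarded also as functions on $\{0,1\}^{\mathbb Z^d}_*$. For a function $F$ on $\{0,1\}^{\mathbb Z^d}_*$, $\nabla_eF(\eta)=F(\eta^e)-F(\eta)$. A form is a map $\omega\colon\Phi_*\to\mathbb R$ with $\omega((\eta',\eta))=-\omega((\eta,\eta'))$, identified with the family $(\omega_e)_e$, $\omega_e(\eta)=\omega((\eta,\eta^e))$; thus a family $(\omega_e)$ is a form iff $\omega_e(\eta)=\omega_{e'}(\eta)$ whenever $\eta^e=\eta^{e'}$, $\omega_e(\eta)=0$ if $\eta^e=\eta$, and $\omega_e(\eta)=-\omega_{\bar e}(\eta^e)$ with $\bar e=(t(e),o(e))$. It is closed if its sum along every closed path in the graph $(\{0,1\}^{\mathbb Z^d}_*,\Phi_* )$ is $0$. For $x\in\mathbb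 Z^d$, $\tau_x$ is translation by $x$ on $\mathbb Z^d$, acting by $\eta^{\tau_x}=(\eta_{y+x})_y$, $\tau_x(f)(\eta)=f(\eta^{\tau_x})$ and $\tau_x(\omega)((\eta,\eta'))=\omega((\eta^{\tau_x},\eta'^{\tau_x}))$; shift-invariant means invariant under all $\tau_x$. The infinite sums in the formula are functions on $\{0,1\}^{\mathbb Z^d}_*$, where they are finite sums at each configuration. *)

theory Defs
  imports "HOL-Analysis.Finite_Cartesian_Product" "HOL-Library.Groups_Big_Fun"
begin

text \<open>
  The lattice \<open>\<int>\<^sup>d\<close> is \<^typ>\<open>int ^ 'd\<close> with \<open>d = CARD('d)\<close>, and the local states are
  \<^typ>\<open>bool\<close>, with \<^term>\<open>False\<close> for the base state \<open>0\<close> and \<^term>\<open>True\<close> for \<open>1\<close>.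
\<close>

type_synonym 'd site = "int ^ 'd"
type_synonym 'd edge = "'d site \<times> 'd site"
type_synonym 'd config = "'d site \<Rightarrow> bool"

definition lattice_edges :: "'d::finite edge set" where
  "lattice_edges = {(x, y). (\<Sum>j\<in>UNIV. \<bar>x $ j - y $ j\<bar>) = 1}"

definition star :: "'d config" where
  "star = (\<lambda>x. False)"

definition fin_configs :: "'d config set" where
  "fin_configs = {\<eta>. finite {x. \<eta> x \<noteq> star x}}"

definition exchange :: "'d edge \<Rightarrow> 'd config \<Rightarrow> 'd config" where
  "exchange e \<eta> = \<eta>(fst e := \<eta> (snd e), snd e := \<eta> (fst e))"

definition transitions :: "('d::finite config \<times> 'd config) set" where
  "transitions = {(\<eta>, exchange e \<eta>) | \<eta> e. \<eta> \<in> fin_configs \<and> e \<in> lattice_edges}"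

definition C_loc :: "('d config \<Rightarrow> real) set" where
  "C_loc = {f. \<exists>\<Lambda>. finite \<Lambda> \<and> (\<forall>\<eta> \<eta>'. (\<forall>x\<in>\<Lambda>. \<eta> x = \<eta>' x) \<longrightarrow> f \<eta> = f \<eta>')}"

definition grad :: "'d edge \<Rightarrow> ('d config \<Rightarrow> real) \<Rightarrow> 'd config \<Rightarrow> real" where
  "grad e F \<eta> = F (exchange e \<eta>) - F \<eta>"

definition occupation :: "'d site \<Rightarrow> 'd config \<Rightarrow> real" where
  "occupation x \<eta> = of_bool (\<eta> x)"

definition shift_config :: "'d::finite site \<Rightarrow> 'd config \<Rightarrow> 'd config" where
  "shift_config x \<eta> = (\<lambda>y. \<eta> (y + x))"

definition shift_fun :: "'d::finite site \<Rightarrow> ('d config \<Rightarrow> real) \<Rightarrow> 'd config \<Rightarrow> real" where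
  "shift_fun x f \<eta> = f (shift_config x \<eta>)"

text \<open>
  Forms are maps on the set \<^const>\<open>transitions\<close>. Here they are total functions on pairs
  of configurations of which only the values on \<^const>\<open>transitions\<close> are ever used.
\<close>

definition is_form :: "('d::finite config \<times> 'd config \<Rightarrow> real) \<Rightarrow> bool" where
  "is_form \<Omega> \<longleftrightarrow> (\<forall>(\<eta>, \<eta>')\<in>transitions. \<Omega> (\<eta>', \<eta>) = - \<Omega> (\<eta>, \<eta>'))"

definition closed_path :: "('d::finite config \<times> 'd config) list \<Rightarrow> bool" where
  "closed_path p \<longleftrightarrow> p \<noteq> [] \<and> set p \<subseteq> transitions \<and>
     successively (\<lambda>\<phi> \<psi>. snd \<phi> = fst \<psi>) p \<and> snd (last p) = fst (hd p)"

definition closed_form :: "('d::finite config \<times> 'd config \<Rightarrow> real) \<Rightarrow> bool" where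
  "closed_form \<Omega> \<longleftrightarrow> is_form \<Omega> \<and> (\<forall>p. closed_path p \<longrightarrow> (\<Sum>\<phi>\<leftarrow>p. \<Omega> \<phi>) = 0)"

definition shift_invariant :: "('d::finite config \<times> 'd config \<Rightarrow> real) \<Rightarrow> bool" where
  "shift_invariant \<Omega> \<longleftrightarrow>
     (\<forall>x. \<forall>(\<eta>, \<eta>')\<in>transitions. \<Omega> (shift_config x \<eta>, shift_config x \<eta>') = \<Omega> (\<eta>, \<eta>'))"

text \<open>
  A form \<open>\<Omega>\<close> is identified with the family of its components \<open>\<omega> e\<close>; the \<open>\<omega> e\<close> may be defined on
  all configurations, but are compared with \<open>\<Omega>\<close> on \<^const>\<open>fin_configs\<close> only.
\<close>

definition components :: "('d::finite config \<times> 'd config \<Rightarrow> real)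
    \<Rightarrow> ('d edge \<Rightarrow> 'd config \<Rightarrow> real) \<Rightarrow> bool" where
  "components \<Omega> \<omega> \<longleftrightarrow>
     (\<forall>e\<in>lattice_edges. \<forall>\<eta>\<in>fin_configs. \<omega> e \<eta> = \<Omega> (\<eta>, exchange e \<eta>))"

text \<open>
  \<^const>\<open>Sum_any\<close> is zero by convention if infinitely many terms are nonzero. By the following
  two facts this does not happen for the sums below, when \<open>f\<close> is local with \<open>f star = 0\<close>
  and they are evaluated on \<^const>\<open>fin_configs\<close>.
\<close>

definition shift_sum :: "('d::finite config \<Rightarrow> real) \<Rightarrow> 'd config \<Rightarrow> real" where
  "shift_sum f \<eta> = Sum_any (\<lambda>x. shift_fun x f \<eta>)"

definition moment :: "'d::finite \<Rightarrow> 'd config \<Rightarrow> real" where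
  "moment j \<eta> = Sum_any (\<lambda>x. real_of_int (x $ j) * occupation x \<eta>)"

lemma finite_shift_sum_support:
  assumes "f \<in> C_loc" "f star = 0" "\<eta> \<in> fin_configs"
  shows "finite {x. shift_fun x f \<eta> \<noteq> 0}"
proof -
  obtain \<Lambda> where \<Lambda>: "finite \<Lambda>"
    "\<And>\<eta> \<eta>'. (\<forall>x\<in>\<Lambda>. \<eta> x = \<eta>' x) \<Longrightarrow> f \<eta> = f \<eta>'"
    using assms(1) unfolding C_loc_def by blast
  have fin: "finite {x. \<eta> x}"
    using assms(3) by (simp add: fin_configs_def star_def)
  have "{x. shift_fun x f \<eta> \<noteq> 0} \<subseteq> (\<lambda>(z, y). z - y) ` ({x. \<eta> x} \<times> \<Lambda>)"
  proof
    fix x assume "x \<in> {x. shift_fun x f \<eta> \<noteq> 0}"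
    then have "f (shift_config x \<eta>) \<noteq> f star"
      using assms(2) by (simp add: shift_fun_def)
    then obtain y where "y \<in> \<Lambda>" "\<eta> (y + x)"
      using \<Lambda>(2)[of "shift_config x \<eta>" star] by (auto simp: shift_config_def star_def)
    then show "x \<in> (\<lambda>(z, y). z - y) ` ({x. \<eta> x} \<times> \<Lambda>)"
      by (intro image_eqI[of _ _ "(y + x, y)"]) auto
  qed
  then show ?thesis
    using fin \<Lambda>(1) finite_subset by blast
qed

lemma finite_moment_support:
  assumes "\<eta> \<in> fin_configs"
  shows "finite {x. real_of_int (x $ j) * occupation x \<eta> \<noteq> 0}"
  by (rule finite_subset[of _ "{x. \<eta> x \<noteq> star x}"])
    (use assms in \<open>auto simp: fin_configs_def star_def occupation_def\<close>)

end

theory Submission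
  imports Defs "HOL-Combinatorics.Transposition"
begin

text \<open>
  A closed form is the gradient of a potential \<open>F\<close>, regarded here as a function of the finite set
  of occupied sites. Expand it into cluster interactions, \<open>F A = (\<Sum>B \<subseteq> A. G B)\<close>, where \<open>G\<close> is the
  Moebius transform of \<open>F\<close>. Shift-invariance makes the range of the components uniform: the change
  of \<open>F\<close> when a particle jumps from \<open>p\<close> to a neighbour \<open>q\<close> is determined by the particles within some
  distance \<open>R\<close> of \<open>p\<close>. Inclusion-exclusion turns this statement about differences of \<open>F\<close> into
  one about single values of \<open>G\<close>: the value \<open>G A\<close> does not change when a particle of \<open>A\<close> jumps
  while another particle of \<open>A\<close> is further than \<open>R\<close> away from it (\<open>mobius_move\<close>).

  Call \<open>A\<close> wide if two of its particles differ by more than \<open>R\<close> in some coordinate. All wide sets of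
  \<open>n\<close> particles are joined by jumps of this kind: one of the two distant particles can be sent as far
  away as desired, and after that the other particles are rearranged freely. Hence
  \<open>G\<close> takes a single value on the wide sets of \<open>n\<close> particles (\<open>mobius_wide_eq\<close>). Subtracting this
  value from \<open>G\<close> on all sets of \<open>n\<close> particles changes \<open>F\<close> only by a function of the number of
  particles, which is conserved, so that the gradient stays the same; what remains of \<open>G\<close> vanishes
  on wide sets, so it has finite range.

  For a translation \<open>v\<close>, the function \<open>F (v + A) - F A\<close> has gradient zero by shift-invariance, hence
  depends on \<open>card A\<close> only, and the same follows for \<open>G (v + A) - G A\<close>. If \<open>card A \<ge> 2\<close> it can
  be evaluated at a wide set, where it is zero: \<open>G\<close> is translation invariant on such sets. If \<open>A\<close> is a
  single site it says that \<open>G {x} - G {0}\<close> is additive in \<open>x\<close>, which yields the constants \<open>a\<close> and the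
  moments. Finally the translation invariant interaction of finite range is a sum of translates
  of one local function: each cluster divides its interaction equally among its sites, and \<open>f\<close>
  collects the shares of the origin.

  Particles are indistinguishable, and the jumps take place in the whole lattice or in half-spaces,
  which are connected by lattice paths in every dimension. This is why one dimension, where two
  particles cannot walk around each other, is not special.
\<close>

section \<open>Lattice edges and exchanges\<close>

lemma edge_coord:
  assumes "(p, q) \<in> lattice_edges"
  shows "\<bar>p $ j - q $ j\<bar> \<le> 1"
proof -
  have "\<bar>p $ j - q $ j\<bar> \<le> (\<Sum>j\<in>UNIV. \<bar>p $ j - q $ j\<bar>)"
    by (rule member_le_sum) auto
  with assms show ?thesis by (simp add: lattice_edges_def)
qed

lemma edge_neq: "(p, q) \<in> lattice_edges \<Longrightarrow> p \<noteq> q"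
  by (auto simp: lattice_edges_def)

lemma lattice_edges_shift: "(v + p, v + q) \<in> lattice_edges \<longleftrightarrow> (p, q) \<in> lattice_edges"
  by (simp add: lattice_edges_def)

lemma exchange_eq_comp_transpose: "exchange (p, q) \<eta> = \<eta> \<circ> transpose p q"
  by (auto simp: exchange_def transpose_def fun_eq_iff)

lemma exchange_exchange: "exchange e (exchange e \<eta>) = \<eta>"
  by (cases e) (simp add: exchange_eq_comp_transpose comp_assoc)

lemma exchange_mem: "exchange (p, q) (\<lambda>x. x \<in> A) = (\<lambda>x. x \<in> transpose p q ` A)"
  unfolding exchange_eq_comp_transpose fun_eq_iff comp_def
  by (metis image_eqI image_iff transpose_involutory)

lemma transpose_image_Diff:
  assumes "a \<in> V" "b \<in> V"
  shows "transpose a b ` A - V = A - V"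
  using assms by (auto simp: in_transpose_image_iff) (auto simp: transpose_def split: if_splits)

lemma transpose_image_replace:
  assumes "a \<in> A" "b \<notin> A"
  shows "transpose a b ` A = insert b (A - {a})"
  using assms by (auto simp: in_transpose_image_iff) (auto simp: transpose_def split: if_splits)

lemma mem_fin_configs_iff: "(\<lambda>x. x \<in> A) \<in> fin_configs \<longleftrightarrow> finite A"
  by (simp add: fin_configs_def star_def)

lemma exchange_fin_configs:
  assumes "\<eta> \<in> fin_configs"
  shows "exchange e \<eta> \<in> fin_configs"
proof -
  obtain p q where e: "e = (p, q)" by (cases e)
  have "exchange e \<eta> = (\<lambda>x. x \<in> transpose p q ` {x. \<eta> x})"
    using exchange_mem[of p q "{x. \<eta> x}"] by (simp add: e)
  moreover have "finite {x. \<eta> x}" using assms by (simp add: fin_configs_def star_def)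
  ultimately show ?thesis by (simp add: mem_fin_configs_iff)
qed

lemma transitions_sym: "(\<eta>, \<zeta>) \<in> transitions \<Longrightarrow> (\<zeta>, \<eta>) \<in> transitions"
proof -
  assume "(\<eta>, \<zeta>) \<in> transitions"
  then obtain e where e: "\<eta> \<in> fin_configs" "e \<in> lattice_edges" "\<zeta> = exchange e \<eta>"
    by (auto simp: transitions_def)
  then have "(\<zeta>, \<eta>) = (\<zeta>, exchange e \<zeta>)" "\<zeta> \<in> fin_configs"
    by (simp_all add: exchange_exchange exchange_fin_configs)
  with e(2) show ?thesis unfolding transitions_def by blast
qed

lemma transition_mem:
  "(p, q) \<in> lattice_edges \<Longrightarrow> finite A \<Longrightarrow>
    ((\<lambda>x. x \<in> A), (\<lambda>x. x \<in> transpose p q ` A)) \<in> transitions"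
  unfolding transitions_def exchange_mem[symmetric] by (blast intro: mem_fin_configs_iff[THEN iffD2])

section \<open>Potentials of closed forms\<close>

fun walk :: "'d::finite config \<Rightarrow> ('d config \<times> 'd config) list \<Rightarrow> 'd config \<Rightarrow> bool" where
  "walk \<eta> [] \<zeta> \<longleftrightarrow> \<eta> = \<zeta>"
| "walk \<eta> (\<phi> # p) \<zeta> \<longleftrightarrow> \<phi> \<in> transitions \<and> fst \<phi> = \<eta> \<and> walk (snd \<phi>) p \<zeta>"

lemma walk_append: "walk \<eta> (p @ q) \<zeta> \<longleftrightarrow> (\<exists>\<theta>. walk \<eta> p \<theta> \<and> walk \<theta> q \<zeta>)"
  by (induction p arbitrary: \<eta>) auto

lemma walk_rev: "walk \<eta> p \<zeta> \<Longrightarrow> walk \<zeta> (rev (map prod.swap p)) \<eta>"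
  by (induction p arbitrary: \<eta>) (auto simp: walk_append prod.swap_def intro: transitions_sym)

lemma walk_path:
  assumes "walk \<eta> p \<zeta>" "p \<noteq> []"
  shows "set p \<subseteq> transitions \<and> successively (\<lambda>\<phi> \<psi>. snd \<phi> = fst \<psi>) p \<and>
    fst (hd p) = \<eta> \<and> snd (last p) = \<zeta>"
  using assms
proof (induction p arbitrary: \<eta>)
  case (Cons \<phi> p)
  then show ?case by (cases p) (auto simp: successively_Cons)
qed simp

lemma closed_form_sum_loop:
  assumes "closed_form \<Omega>" "walk \<eta> p \<eta>"
  shows "(\<Sum>\<phi>\<leftarrow>p. \<Omega> \<phi>) = 0"
proof (cases "p = []")
  case False
  with walk_path[OF assms(2)] have "closed_path p" by (simp add: closed_path_def)
  with assms(1) show ?thesis by (simp add: closed_form_def)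
qed simp

lemma form_sum_rev:
  assumes "is_form \<Omega>" "walk \<eta> p \<zeta>"
  shows "(\<Sum>\<phi>\<leftarrow>rev (map prod.swap p). \<Omega> \<phi>) = - (\<Sum>\<phi>\<leftarrow>p. \<Omega> \<phi>)"
  using assms(2)
proof (induction p arbitrary: \<eta>)
  case (Cons \<phi> p)
  have "\<Omega> (prod.swap \<phi>) = - \<Omega> \<phi>"
    using assms(1) Cons.prems by (cases \<phi>) (auto simp: is_form_def)
  with Cons.IH[of "snd \<phi>"] Cons.prems show ?case by simp
qed simp

lemma closed_form_sum_walk_unique:
  assumes "closed_form \<Omega>" "walk \<eta> p \<zeta>" "walk \<eta> q \<zeta>"
  shows "(\<Sum>\<phi>\<leftarrow>p. \<Omega> \<phi>) = (\<Sum>\<phi>\<leftarrow>q. \<Omega> \<phi>)"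
proof -
  have "walk \<eta> (p @ rev (map prod.swap q)) \<eta>"
    using assms(2,3) walk_rev walk_append by blast
  from closed_form_sum_loop[OF assms(1) this] form_sum_rev[OF _ assms(3), of \<Omega>] assms(1)
  show ?thesis by (simp add: closed_form_def)
qed

text \<open>
  In each connected component of the transition graph a base configuration is chosen by a
  choice that depends only on the component, and the potential sums the form along a walk from there.
\<close>
lemma closed_form_potential:
  fixes \<Omega> :: "'d::finite config \<times> 'd config \<Rightarrow> real"
  assumes "closed_form \<Omega>"
  obtains F where "\<And>\<eta> \<zeta>. (\<eta>, \<zeta>) \<in> transitions \<Longrightarrow> \<Omega> (\<eta>, \<zeta>) = F \<zeta> - F \<eta>"
proof -
  define base where "base \<eta> = (SOME \<theta>. \<exists>p. walk \<theta> p \<eta>)" for \<eta> :: "'d config"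
  define path where "path \<eta> = (SOME p. walk (base \<eta>) p \<eta>)" for \<eta> :: "'d config"
  have "\<exists>p. walk (base \<eta>) p \<eta>" for \<eta> :: "'d config"
  proof -
    have "walk \<eta> [] \<eta>" by simp
    then have "\<exists>\<theta> p. walk \<theta> p \<eta>" by blast
    from someI_ex[OF this] show ?thesis by (simp add: base_def)
  qed
  from someI_ex[OF this] have path: "walk (base \<eta>) (path \<eta>) \<eta>" for \<eta> :: "'d config"
    by (simp add: path_def)
  show ?thesis
  proof (rule that[of "\<lambda>\<eta>. \<Sum>\<phi>\<leftarrow>path \<eta>. \<Omega> \<phi>"])
    fix \<eta> \<zeta> :: "'d config" assume t: "(\<eta>, \<zeta>) \<in> transitions"
    have "(\<exists>p. walk \<theta> p \<eta>) \<longleftrightarrow> (\<exists>p. walk \<theta> p \<zeta>)" for \<theta>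
    proof
      assume "\<exists>p. walk \<theta> p \<eta>"
      then obtain p where "walk \<theta> p \<eta>" ..
      then have "walk \<theta> (p @ [(\<eta>, \<zeta>)]) \<zeta>" using t by (auto simp: walk_append)
      then show "\<exists>p. walk \<theta> p \<zeta>" ..
    next
      assume "\<exists>p. walk \<theta> p \<zeta>"
      then obtain p where "walk \<theta> p \<zeta>" ..
      then have "walk \<theta> (p @ [(\<zeta>, \<eta>)]) \<eta>" using t by (auto simp: walk_append transitions_sym)
      then show "\<exists>p. walk \<theta> p \<eta>" ..
    qed
    then have b: "base \<eta> = base \<zeta>" by (simp add: base_def)
    have "walk (base \<zeta>) (path \<eta> @ [(\<eta>, \<zeta>)]) \<zeta>"
      using path[of \<eta>] t by (auto simp: walk_append b)
    from closed_form_sum_walk_unique[OF assms this path[of \<zeta>]]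
    show "\<Omega> (\<eta>, \<zeta>) = (\<Sum>\<phi>\<leftarrow>path \<zeta>. \<Omega> \<phi>) - (\<Sum>\<phi>\<leftarrow>path \<eta>. \<Omega> \<phi>)" by simp
  qed
qed

section \<open>Moving particles inside box-convex regions\<close>

text \<open>
  With two sites, a box-convex region contains all shortest lattice paths between them. Whole
  space and half-spaces are the instances of interest.
\<close>
definition box_convex :: "'d::finite site set \<Rightarrow> bool" where
  "box_convex V \<longleftrightarrow> (\<forall>a\<in>V. \<forall>b\<in>V. \<forall>c.
     (\<forall>i. min (a $ i) (b $ i) \<le> c $ i \<and> c $ i \<le> max (a $ i) (b $ i)) \<longrightarrow> c \<in> V)"

lemma box_convex_halfspaces:
  "box_convex {v. c < v $ i}" "box_convex {v. v $ i < c}"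
proof -
  have "c < z" if "c < x" "c < y" "min x y \<le> z" for x y z :: int using that by linarith
  moreover have "z < c" if "x < c" "y < c" "z \<le> max x y" for x y z :: int using that by linarith
  ultimately show "box_convex {v. c < v $ i}" "box_convex {v. v $ i < c}"
    unfolding box_convex_def by blast+
qed

lemma step_towards:
  fixes a b :: "'d::finite site"
  assumes "a \<noteq> b"
  obtains c where "(a, c) \<in> lattice_edges"
    "\<And>i. min (a $ i) (b $ i) \<le> c $ i \<and> c $ i \<le> max (a $ i) (b $ i)"
    "(\<Sum>j\<in>UNIV. \<bar>c $ j - b $ j\<bar>) < (\<Sum>j\<in>UNIV. \<bar>a $ j - b $ j\<bar>)"
proof -
  obtain i where i: "a $ i \<noteq> b $ i" using assms by (auto simp: vec_eq_iff)
  define c where "c = a + axis i (sgn (b $ i - a $ i))"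
  have c: "c $ k = (if k = i then a $ i + sgn (b $ i - a $ i) else a $ k)" for k
    by (simp add: c_def axis_def)
  have "(\<Sum>j\<in>UNIV. \<bar>a $ j - c $ j\<bar>) = (\<Sum>j\<in>UNIV. if j = i then 1 else 0)"
    by (rule sum.cong) (use i in \<open>auto simp: c sgn_if\<close>)
  then have "(a, c) \<in> lattice_edges" by (simp add: lattice_edges_def)
  moreover have "min (a $ k) (b $ k) \<le> c $ k \<and> c $ k \<le> max (a $ k) (b $ k)" for k
    using i by (auto simp: c sgn_if)
  moreover have "(\<Sum>j\<in>UNIV. \<bar>c $ j - b $ j\<bar>) < (\<Sum>j\<in>UNIV. \<bar>a $ j - b $ j\<bar>)"
    by (rule sum_strict_mono_ex1) (use i in \<open>auto simp: c sgn_if intro!: bexI[of _ i]\<close>)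
  ultimately show ?thesis by (rule that)
qed

text \<open>
  Invariance under exchanges along edges passes to exchanges of arbitrary sites, since a transposition
  \<open>(a b)\<close> is the product \<open>(a c) (c b) (a c)\<close>, where \<open>c\<close> is the next site on a shortest path from \<open>a\<close>
  to \<open>b\<close>. In this form it does not matter whether the path is occupied by other particles.
  The configuration \<open>C\<close> outside the region \<open>V\<close> is fixed throughout, and serves
  below to keep a distant particle in place.
\<close>
lemma invariant_transpose:
  assumes V: "box_convex V"
    and inv: "\<And>p q A. (p, q) \<in> lattice_edges \<Longrightarrow> p \<in> V \<Longrightarrow> q \<in> V \<Longrightarrow>
      finite A \<Longrightarrow> A - V = C \<Longrightarrow> P (transpose p q ` A) = P A"
    and "a \<in> V" "b \<in> V" "finite A" "A - V = C"
  shows "P (transpose a b ` A) = P A"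
  using assms(3-)
proof (induction "nat (\<Sum>j\<in>UNIV. \<bar>a $ j - b $ j\<bar>)" arbitrary: a A rule: less_induct)
  case less
  show ?case
  proof (cases "a = b")
    case False
    then obtain c where c: "(a, c) \<in> lattice_edges"
      "\<And>i. min (a $ i) (b $ i) \<le> c $ i \<and> c $ i \<le> max (a $ i) (b $ i)"
      "(\<Sum>j\<in>UNIV. \<bar>c $ j - b $ j\<bar>) < (\<Sum>j\<in>UNIV. \<bar>a $ j - b $ j\<bar>)"
      by (rule step_towards) blast
    have cV: "c \<in> V" using V c(2) less.prems(1,2) unfolding box_convex_def by blast
    show ?thesis
    proof (cases "c = b")
      case True
      then show ?thesis using inv c(1) less.prems by blast
    next
      case cb: False
      have "0 \<le> (\<Sum>j\<in>UNIV. \<bar>c $ j - b $ j\<bar>)" by (simp add: sum_nonneg)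
      then have lt: "nat (\<Sum>j\<in>UNIV. \<bar>c $ j - b $ j\<bar>) < nat (\<Sum>j\<in>UNIV. \<bar>a $ j - b $ j\<bar>)"
        using c(3) by linarith
      let ?A1 = "transpose a c ` A" and ?A2 = "transpose c b ` transpose a c ` A"
      have A1: "finite ?A1" "?A1 - V = C"
        using less.prems cV by (simp_all add: transpose_image_Diff)
      have A2: "finite ?A2" "?A2 - V = C"
        using less.prems cV by (simp_all add: transpose_image_Diff)
      have "transpose a b = transpose a c \<circ> transpose c b \<circ> transpose a c"
        using False cb by (simp add: transpose_comp_triple)
      then have "transpose a b ` A = transpose a c ` ?A2" by (simp add: image_comp comp_assoc)
      then have "P (transpose a b ` A) = P ?A2"
        using inv[OF c(1) less.prems(1) cV A2] by simp
      also have "\<dots> = P ?A1" using less.hyps[OF lt cV less.prems(2) A1] .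
      also have "\<dots> = P A" using inv[OF c(1) less.prems(1) cV less.prems(3,4)] .
      finally show ?thesis .
    qed
  qed simp
qed

lemma invariant_card_eq:
  assumes V: "box_convex V"
    and inv: "\<And>p q A. (p, q) \<in> lattice_edges \<Longrightarrow> p \<in> V \<Longrightarrow> q \<in> V \<Longrightarrow>
      finite A \<Longrightarrow> A - V = C \<Longrightarrow> P (transpose p q ` A) = P A"
    and "finite A" "A - V = C" and B: "finite B" "B - V = C" and "card A = card B"
  shows "P A = P B"
  using assms(3,4,7)
proof (induction "card (A - B)" arbitrary: A)
  case 0
  then have "A \<subseteq> B" by simp
  then show ?case using 0 B by (metis card_subset_eq)
next
  case (Suc n)
  have "card (B - A) = card (A - B)"
    using Suc.prems B by (metis card_le_sym_Diff order_antisym order_refl)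
  then have "B - A \<noteq> {}" "A - B \<noteq> {}" using Suc(2) by (metis card.empty nat.distinct(1))+
  then obtain a b where a: "a \<in> A" "a \<notin> B" and b: "b \<in> B" "b \<notin> A" by blast
  have ab: "a \<in> V" "b \<in> V" using a b Suc.prems(2) B(2) by blast+
  let ?A = "transpose a b ` A"
  have A: "?A = insert b (A - {a})" using a b by (simp add: transpose_image_replace)
  have "?A - B = (A - B) - {a}" using A a b by auto
  then have "card (?A - B) = n" using Suc(2) a Suc.prems(1) by simp
  moreover have "finite ?A" "?A - V = C" "card ?A = card B"
    using Suc.prems ab by (simp_all add: transpose_image_Diff card_image)
  ultimately have "P ?A = P B" using Suc(1) by metis
  moreover have "P ?A = P A"
    by (rule invariant_transpose[where P = P and C = C, OF V inv ab Suc.prems(1,2)])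
  ultimately show ?case by simp
qed

section \<open>Moebius transform of a set function\<close>

definition mobius :: "('a set \<Rightarrow> real) \<Rightarrow> 'a set \<Rightarrow> real" where
  "mobius F A = (\<Sum>B\<in>Pow A. (- 1) ^ card (A - B) * F B)"

lemma mobius_cong: "(\<And>B. B \<subseteq> A \<Longrightarrow> F B = F' B) \<Longrightarrow> mobius F A = mobius F' A"
  unfolding mobius_def by (rule sum.cong) auto

lemma mobius_diff: "mobius (\<lambda>B. F B - F' B) A = mobius F A - mobius F' A"
  by (simp add: mobius_def right_diff_distrib sum_subtractf)

lemma sum_Pow_insert:
  fixes h :: "'a set \<Rightarrow> real"
  assumes "finite A" "z \<notin> A"
  shows "sum h (Pow (insert z A)) = sum h (Pow A) + (\<Sum>B\<in>Pow A. h (insert z B))"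
proof -
  have "inj_on (insert z) (Pow A)" using assms(2) by (auto simp: inj_on_def)
  moreover have "Pow A \<inter> insert z ` Pow A = {}" using assms(2) by auto
  ultimately show ?thesis
    using assms(1) by (simp add: Pow_insert sum.union_disjoint sum.reindex)
qed

text \<open>
  Transforming in one variable means taking a difference; iterating this for several points exhibits
  the transform as a mixed difference.
\<close>
lemma mobius_insert:
  assumes "finite A" "z \<notin> A"
  shows "mobius F (insert z A) = mobius (\<lambda>B. F (insert z B) - F B) A"
proof -
  have "card (insert z A - B) = Suc (card (A - B))" if "B \<subseteq> A" for B
  proof -
    have "insert z A - B = insert z (A - B)" using that assms(2) by auto
    then show ?thesis using assms by simp
  qed
  moreover have "insert z A - insert z B = A - B" if "B \<subseteq> A" for B using that assms(2) by auto
  ultimately show ?thesis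
    using assms
    by (simp add: mobius_def sum_Pow_insert right_diff_distrib sum_subtractf sum_negf)
qed

lemma sum_mobius:
  assumes "finite A"
  shows "(\<Sum>B\<in>Pow A. mobius F B) = F A"
  using assms
proof (induction A arbitrary: F)
  case empty
  then show ?case by (simp add: mobius_def)
next
  case (insert z A)
  have "mobius F (insert z B) = mobius (\<lambda>B. F (insert z B) - F B) B" if "B \<in> Pow A" for B
    using that insert.hyps by (intro mobius_insert) (auto intro: finite_subset)
  then show ?case
    using insert by (simp add: sum_Pow_insert)
qed

lemma sum_Pow_image:
  fixes h :: "'b set \<Rightarrow> real"
  assumes "inj \<sigma>"
  shows "sum h (Pow (\<sigma> ` A)) = (\<Sum>B\<in>Pow A. h (\<sigma> ` B))"
proof -
  have "inj_on ((`) \<sigma>) (Pow A)" using assms by (metis inj_image_eq_iff inj_onI)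
  then show ?thesis by (simp add: image_Pow_surj[OF refl, symmetric] sum.reindex)
qed

lemma mobius_image:
  assumes "inj \<sigma>"
  shows "mobius F (\<sigma> ` A) = mobius (\<lambda>B. F (\<sigma> ` B)) A"
proof -
  have "card (\<sigma> ` A - \<sigma> ` B) = card (A - B)" for B
    by (metis assms card_image image_set_diff inj_on_subset subset_UNIV)
  then show ?thesis by (simp add: mobius_def sum_Pow_image[OF assms])
qed

lemma sum_singletons:
  fixes h :: "'a \<Rightarrow> real"
  assumes "finite A"
  shows "(\<Sum>B\<in>Pow A. if card B = 1 then h (the_elem B) else 0) = (\<Sum>x\<in>A. h x)"
proof -
  have "(\<Sum>B\<in>Pow A. if card B = 1 then h (the_elem B) else 0) =
      (\<Sum>B\<in>{B \<in> Pow A. card B = 1}. h (the_elem B))"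
    using assms by (intro sum.inter_filter[symmetric]) simp
  also have "{B \<in> Pow A. card B = 1} = (\<lambda>x. {x}) ` A"
    by (auto simp: card_1_singleton_iff)
  also have "(\<Sum>B\<in>(\<lambda>x. {x}) ` A. h (the_elem B)) = (\<Sum>x\<in>A. h x)"
    by (simp add: sum.reindex inj_on_def)
  finally show ?thesis .
qed

section \<open>Rigidity of the cluster expansion\<close>

text \<open>
  What remains of a shift-invariant closed form with local components once a potential \<open>F\<close> is chosen.
  Only the gradient of \<open>F\<close> is local and shift-invariant; \<open>F\<close> itself need not be. The range \<open>R\<close>
  is at least the length of an edge, so that a site further than \<open>R\<close> from one end of an edge is not the other end.
\<close>
locale local_potential =
  fixes F :: "'d::finite site set \<Rightarrow> real" and R :: int
  assumes R: "1 \<le> R"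
    and local: "\<And>p q A B. (p, q) \<in> lattice_edges \<Longrightarrow> finite A \<Longrightarrow> finite B \<Longrightarrow>
      (\<And>x. (\<forall>i. \<bar>x $ i - p $ i\<bar> \<le> R) \<Longrightarrow> x \<in> A \<longleftrightarrow> x \<in> B) \<Longrightarrow>
      F (transpose p q ` A) - F A = F (transpose p q ` B) - F B"
    and shift: "\<And>p q A v. (p, q) \<in> lattice_edges \<Longrightarrow> finite A \<Longrightarrow>
      F ((+) v ` transpose p q ` A) - F ((+) v ` A) = F (transpose p q ` A) - F A"
begin

abbreviation G where "G \<equiv> mobius F"

text \<open>
  The transform at \<open>insert u (insert z B)\<close> is a sum over \<open>C \<subseteq> B\<close> of mixed differences of \<open>F\<close> in \<open>u\<close>
  and \<open>z\<close>. Between \<open>u = p\<close> and \<open>u = q\<close> these differ by the effect of \<open>z\<close> on the jump from \<open>p\<close> to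
  \<open>q\<close>, and there is none because \<open>z\<close> is out of range.
\<close>
lemma mobius_move_insert:
  assumes e: "(p, q) \<in> lattice_edges" and B: "finite B" "p \<notin> B" "q \<notin> B" "z \<notin> B"
    and z: "R < \<bar>z $ j - p $ j\<bar>"
  shows "G (insert q (insert z B)) = G (insert p (insert z B))"
proof -
  have zpq: "z \<noteq> p" "z \<noteq> q" using z R edge_coord[OF e, of j] by (auto simp: abs_minus_commute)
  have exp: "G (insert u (insert z B)) =
      mobius (\<lambda>C. (F (insert u (insert z C)) - F (insert z C)) - (F (insert u C) - F C)) B"
    if "u \<notin> B" "u \<noteq> z" for u
    using that B by (simp add: mobius_insert insert_commute)
  show ?thesis
    unfolding exp[OF \<open>q \<notin> B\<close> zpq(2)[symmetric]] exp[OF \<open>p \<notin> B\<close> zpq(1)[symmetric]]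
  proof (rule mobius_cong)
    fix C assume "C \<subseteq> B"
    with B have C: "finite C" "p \<notin> C" "q \<notin> C" by (auto intro: finite_subset)
    have "F (transpose p q ` insert p (insert z C)) - F (insert p (insert z C)) =
        F (transpose p q ` insert p C) - F (insert p C)"
      by (rule local[OF e]) (use C z linorder_not_less in auto)
    moreover have "transpose p q ` insert p (insert z C) = insert q (insert z C)"
      using C zpq edge_neq[OF e] by (subst transpose_image_replace) auto
    moreover have "transpose p q ` insert p C = insert q C"
      using C edge_neq[OF e] by (subst transpose_image_replace) auto
    ultimately show "(F (insert q (insert z C)) - F (insert z C)) - (F (insert q C) - F C) =
        (F (insert p (insert z C)) - F (insert z C)) - (F (insert p C) - F C)"
      by simp
  qed
qed

lemma mobius_move:
  assumes e: "(p, q) \<in> lattice_edges" and A: "finite A" "z \<in> A"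
    and z: "R < \<bar>z $ j - p $ j\<bar>"
  shows "G (transpose p q ` A) = G A"
proof -
  have zpq: "z \<noteq> p" "z \<noteq> q" using z R edge_coord[OF e, of j] by (auto simp: abs_minus_commute)
  define B where "B = A - {p, q, z}"
  have eq: "G (insert q (insert z B)) = G (insert p (insert z B))"
    by (rule mobius_move_insert[OF e _ _ _ _ z]) (use A in \<open>auto simp: B_def\<close>)
  consider "p \<in> A" "q \<notin> A" | "p \<notin> A" "q \<in> A" | "p \<in> A \<longleftrightarrow> q \<in> A" by blast
  then show ?thesis
  proof cases
    case 1
    then have "A = insert p (insert z B)" using A(2) by (auto simp: B_def)
    moreover have "transpose p q ` A = insert q (insert z B)"
      using 1 A(2) zpq by (auto simp: transpose_image_replace B_def)
    ultimately show ?thesis using eq by simp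
  next
    case 2
    then have "A = insert q (insert z B)" using A(2) by (auto simp: B_def)
    moreover have "transpose p q ` A = insert p (insert z B)"
      using 2 A(2) zpq by (auto simp: transpose_image_replace transpose_commute[of p q] B_def)
    ultimately show ?thesis using eq by simp
  next
    case 3
    then show ?thesis by simp
  qed
qed

definition wide :: "'d site set \<Rightarrow> bool" where
  "wide A \<longleftrightarrow> (\<exists>j. \<exists>x\<in>A. \<exists>y\<in>A. x $ j + R < y $ j)"

text \<open>
  The particle at \<open>x\<close> stays in place and is far from every site of the half-space in which the
  particle travels from \<open>y\<close> to \<open>q\<close>.
\<close>
lemma mobius_send_away:
  assumes A: "finite A" "x \<in> A" "y \<in> A" "x $ j + R < y $ j"
    and q: "x $ j + R < q $ j" "q \<notin> A"
  shows "G A = G (insert q (A - {y}))"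
proof -
  define V where "V = {v :: 'd site. x $ j + R < v $ j}"
  have V: "box_convex V" unfolding V_def by (rule box_convex_halfspaces)
  have "G (transpose y q ` A) = G A"
  proof (rule invariant_transpose[where P = G and C = "A - V", OF V])
    fix p' q' A' assume *: "(p', q') \<in> lattice_edges" "p' \<in> V" "finite A'" "A' - V = A - V"
    have "x \<notin> V" using R by (simp add: V_def)
    with *(4) A(2) have "x \<in> A'" by blast
    then show "G (transpose p' q' ` A') = G A'"
      by (rule mobius_move[OF *(1,3), of x j]) (use *(2) in \<open>auto simp: V_def\<close>)
  qed (use A q in \<open>auto simp: V_def\<close>)
  with A q show ?thesis by (simp add: transpose_image_replace)
qed

text \<open>
  The two sets may be wide in different coordinates. Therefore the distant particle is sent to a
  site \<open>q\<close> all of whose coordinates are large: it can be reached from either set, and seen from \<open>q\<close>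
  all other particles of both sets lie in one half-space of distant sites, in which they can be
  moved onto each other.
\<close>
lemma mobius_wide_eq:
  assumes A: "finite A" "wide A" and B: "finite B" "wide B" and card: "card A = card B"
  shows "G A = G B"
proof -
  obtain i x y where x: "x \<in> A" "y \<in> A" "x $ i + R < y $ i" using A(2) by (auto simp: wide_def)
  obtain j u w where u: "u \<in> B" "w \<in> B" "u $ j + R < w $ j" using B(2) by (auto simp: wide_def)
  define S where "S = (\<Union>v\<in>A \<union> B. range (\<lambda>i. v $ i))"
  \<comment> \<open>beyond every coordinate of \<open>A\<close> and \<open>B\<close>, by more than the range\<close>
  define M where "M = Max S + R + 1"
  have "finite S" using A(1) B(1) by (simp add: S_def)
  have M: "v $ k + R < M" if "v \<in> A \<union> B" for v k
  proof -
    have "v $ k \<in> S" using that by (auto simp: S_def)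
    then have "v $ k \<le> Max S" using \<open>finite S\<close> by simp
    then show ?thesis by (simp add: M_def)
  qed
  define q :: "'d site" where "q = (\<chi> k. M)"
  have q: "q $ k = M" for k by (simp add: q_def)
  have qAB: "q \<notin> A" "q \<notin> B" using M[of q] q R by fastforce+
  define V where "V = {v :: 'd site. v $ i < M - R}"
  have V: "box_convex V" unfolding V_def by (rule box_convex_halfspaces)
  have inV: "v \<in> V" if "v \<in> A \<union> B" for v using M[OF that, of i] by (simp add: V_def)
  have "q \<notin> V" using R by (simp add: V_def q)
  have "G A = G (insert q (A - {y}))"
    by (rule mobius_send_away[OF A(1) x]) (use M x q qAB in auto)
  \<comment> \<open>with \<open>q\<close> fixed outside \<open>V\<close>, rearrange the other particles inside \<open>V\<close>\<close>
  also have "\<dots> = G (insert q (B - {w}))"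
  proof (rule invariant_card_eq[where P = G and C = "{q}", OF V])
    fix p' q' A' assume *: "(p', q') \<in> lattice_edges" "p' \<in> V" "finite A'" "A' - V = {q}"
    have "q \<in> A'" using *(4) by blast
    then show "G (transpose p' q' ` A') = G A'"
      by (rule mobius_move[OF *(1,3), of q i]) (use *(2) in \<open>simp add: V_def q\<close>)
  next
    show "insert q (A - {y}) - V = {q}" "insert q (B - {w}) - V = {q}"
      using inV \<open>q \<notin> V\<close> by blast+
    show "card (insert q (A - {y})) = card (insert q (B - {w}))"
      using A B card x u qAB by (simp add: card_Suc_Diff1)
  qed (use A B in auto)
  also have "\<dots> = G B"
    by (rule mobius_send_away[OF B(1) u, symmetric]) (use M u q qAB in auto)
  finally show ?thesis .
qed

text \<open>
  A reference set for each number of particles: wide as soon as there are two of them, and equal to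
  \<open>{0}\<close> if there is one.
\<close>
definition ladder :: "nat \<Rightarrow> 'd site set" where
  "ladder n = (\<lambda>k. \<chi> i. (R + 1) * int k) ` {..<n}"

lemma finite_ladder: "finite (ladder n)"
  by (simp add: ladder_def)

lemma card_ladder: "card (ladder n) = n"
proof -
  have "inj_on (\<lambda>k. (\<chi> i. (R + 1) * int k) :: 'd site) {..<n}"
    using R by (auto simp: inj_on_def vec_eq_iff)
  then show ?thesis by (simp add: ladder_def card_image)
qed

lemma wide_ladder:
  assumes "2 \<le> n"
  shows "wide (ladder n)"
proof -
  define x :: "nat \<Rightarrow> 'd site" where "x k = (\<chi> i. (R + 1) * int k)" for k
  have "x k \<in> ladder n" if "k < n" for k using that by (simp add: ladder_def x_def)
  then have "x 0 \<in> ladder n" "x 1 \<in> ladder n" using assms by simp_all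
  moreover have "x 0 $ undefined + R < x 1 $ undefined" by (simp add: x_def)
  ultimately show ?thesis unfolding wide_def by blast
qed

lemma wide_shift: "wide ((+) v ` A) \<longleftrightarrow> wide A"
  by (auto simp: wide_def)

text \<open>
  The difference of \<open>F\<close> and its translate has gradient zero. The Moebius transform commutes with
  exchanges of sites, so that of the difference is invariant under all of them.
\<close>
lemma mobius_shift_diff_card:
  assumes "finite A" "finite B" "card A = card B"
  shows "G ((+) v ` A) - G A = G ((+) v ` B) - G B"
proof -
  define Q where "Q A = F ((+) v ` A) - F A" for A
  have Q: "G ((+) v ` A) - G A = mobius Q A" for A
    unfolding Q_def mobius_diff by (simp add: mobius_image)
  have "mobius Q A = mobius Q B"
  proof (rule invariant_card_eq[where P = "mobius Q" and C = "{}" and V = UNIV])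
    fix p q :: "'d site" and A :: "'d site set"
    assume *: "(p, q) \<in> lattice_edges" "finite A"
    have "mobius Q (transpose p q ` A) = mobius (\<lambda>B. Q (transpose p q ` B)) A"
      by (simp add: mobius_image)
    also have "\<dots> = mobius Q A"
    proof (rule mobius_cong)
      fix B assume "B \<subseteq> A"
      with * have "finite B" by (auto intro: finite_subset)
      from shift[OF *(1) this, of v] show "Q (transpose p q ` B) = Q B" by (simp add: Q_def)
    qed
    finally show "mobius Q (transpose p q ` A) = mobius Q A" .
  qed (use assms in \<open>auto simp: box_convex_def\<close>)
  then show ?thesis by (simp add: Q)
qed

text \<open>
  By the previous lemma any set of the same size may be tested instead of \<open>A\<close>. From two particles
  on there is a wide one, and its translate is wide as well.
\<close>
lemma mobius_shift:
  assumes "finite A" "2 \<le> card A"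
  shows "G ((+) v ` A) = G A"
proof -
  let ?L = "ladder (card A)"
  have "G ((+) v ` A) - G A = G ((+) v ` ?L) - G ?L"
    using assms(1) by (intro mobius_shift_diff_card) (simp_all add: finite_ladder card_ladder)
  also have "G ((+) v ` ?L) = G ?L"
    by (rule mobius_wide_eq)
      (simp_all add: finite_ladder wide_shift wide_ladder assms(2) card_image)
  finally show ?thesis by simp
qed

definition slope :: "'d site \<Rightarrow> real" where
  "slope x = G {x} - G {0}"

lemma slope_add: "slope (x + y) = slope x + slope y"
  using mobius_shift_diff_card[of "{y}" "{0}" x] by (simp add: slope_def)

text \<open>
  The ladder value is what \<open>G\<close> takes on all wide sets of the same size. On single sites the whole
  transform is removed: it is \<open>slope\<close> up to the constant \<open>G {0}\<close>, which is the ladder value there.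
\<close>
definition interaction :: "'d site set \<Rightarrow> real" where
  "interaction A = (if card A = 1 then 0 else G A - G (ladder (card A)))"

lemma interaction_shift:
  assumes "finite A"
  shows "interaction ((+) v ` A) = interaction A"
proof (cases "2 \<le> card A")
  case True
  with mobius_shift[OF assms this] show ?thesis by (simp add: interaction_def card_image)
next
  case False
  then have "card A = 0 \<or> card A = 1" by linarith
  then show ?thesis using assms by (auto simp: interaction_def card_image)
qed

lemma interaction_empty: "interaction {} = 0"
  by (simp add: interaction_def ladder_def)

lemma interaction_wide:
  assumes "finite A" "wide A"
  shows "interaction A = 0"
proof (cases "card A = 1")
  case False
  have "card A \<noteq> 0" using assms by (auto simp: wide_def)
  with False have "2 \<le> card A" by linarith
  with mobius_wide_eq[OF assms finite_ladder wide_ladder[OF this]] show ?thesis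
    by (simp add: interaction_def card_ladder)
qed (simp add: interaction_def)

lemma mobius_eq_interaction:
  "G A = interaction A + G (ladder (card A)) + (if card A = 1 then slope (the_elem A) else 0)"
proof (cases "card A = 1")
  case True
  then obtain x where "A = {x}" by (auto simp: card_1_singleton_iff)
  moreover have "ladder 1 = {0}" by (auto simp: ladder_def vec_eq_iff)
  ultimately show ?thesis by (simp add: interaction_def slope_def)
qed (simp add: interaction_def)

lemma potential_decomposition:
  assumes "finite A"
  shows "F A = (\<Sum>B\<in>Pow A. interaction B) + (\<Sum>x\<in>A. slope x) + (\<Sum>B\<in>Pow A. G (ladder (card B)))"
proof -
  have "F A = (\<Sum>B\<in>Pow A. interaction B + G (ladder (card B)) +
      (if card B = 1 then slope (the_elem B) else 0))"
    unfolding mobius_eq_interaction[symmetric] by (rule sum_mobius[OF assms, symmetric])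
  then show ?thesis using sum_singletons[OF assms] by (simp add: sum.distrib)
qed

text \<open>
  The last sum in \<open>potential_decomposition\<close> depends on \<open>card A\<close> only and cancels.
\<close>
lemma gradient_decomposition:
  assumes "finite A"
  shows "F (transpose p q ` A) - F A =
    ((\<Sum>B\<in>Pow (transpose p q ` A). interaction B) + (\<Sum>x\<in>transpose p q ` A. slope x)) -
    ((\<Sum>B\<in>Pow A. interaction B) + (\<Sum>x\<in>A. slope x))"
proof -
  have "(\<Sum>B\<in>Pow (transpose p q ` A). G (ladder (card B))) = (\<Sum>B\<in>Pow A. G (ladder (card B)))"
    by (simp only: sum_Pow_image[OF inj_transpose] card_image[OF inj_on_transpose])
  then show ?thesis
    using potential_decomposition[OF assms] potential_decomposition[of "transpose p q ` A"] assms
    by simp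
qed

end

section \<open>Local components of a shift-invariant form\<close>

lemma finite_box: "finite {v :: int ^ 'd::finite. \<forall>i. \<bar>v $ i\<bar> \<le> r}"
proof (rule finite_imageD[of vec_nth])
  have "vec_nth ` {v :: int ^ 'd. \<forall>i. \<bar>v $ i\<bar> \<le> r} \<subseteq> (UNIV \<rightarrow>\<^sub>E {- r..r})"
    by (auto simp: abs_le_iff minus_le_iff)
  then show "finite (vec_nth ` {v :: int ^ 'd. \<forall>i. \<bar>v $ i\<bar> \<le> r})"
    by (rule finite_subset) (simp add: finite_PiE)
qed (simp add: inj_on_def vec_nth_inject)

lemma finite_edges_at_origin: "finite {q :: 'd::finite site. (0, q) \<in> lattice_edges}"
proof (rule finite_subset)
  show "{q :: 'd site. (0, q) \<in> lattice_edges} \<subseteq> {v. \<forall>i. \<bar>v $ i\<bar> \<le> 1}"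
    using edge_coord[of 0] by auto
  show "finite {v :: 'd site. \<forall>i. \<bar>v $ i\<bar> \<le> 1}" by (rule finite_box)
qed

lemma shift_config_mem: "shift_config v (\<lambda>x. x \<in> A) = (\<lambda>x. x \<in> (+) (- v) ` A)"
  by (auto simp: shift_config_def fun_eq_iff image_iff algebra_simps)

lemma shift_transpose_image:
  fixes v :: "'a::ab_group_add"
  shows "(+) v ` transpose p q ` A = transpose (v + p) (v + q) ` (+) v ` A"
proof -
  have "(+) v \<circ> transpose p q = transpose (v + p) (v + q) \<circ> (+) v"
    by (simp add: fun_eq_iff transpose_def)
  then show ?thesis by (simp only: image_comp)
qed

lemma shift_invariant_mem:
  assumes "shift_invariant \<Omega>" "(p, q) \<in> lattice_edges" "finite A"
  shows "\<Omega> ((\<lambda>x. x \<in> (+) v ` A), (\<lambda>x. x \<in> (+) v ` transpose p q ` A)) =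
    \<Omega> ((\<lambda>x. x \<in> A), (\<lambda>x. x \<in> transpose p q ` A))"
proof -
  have "\<Omega> (shift_config (- v) (\<lambda>x. x \<in> A), shift_config (- v) (\<lambda>x. x \<in> transpose p q ` A)) =
    \<Omega> ((\<lambda>x. x \<in> A), (\<lambda>x. x \<in> transpose p q ` A))"
    using assms(1) transition_mem[OF assms(2,3)] unfolding shift_invariant_def by blast
  then show ?thesis by (simp only: shift_config_mem minus_minus)
qed

text \<open>
  Up to translation there are only finitely many edges, those starting at the origin, and
  each of their components sees finitely many sites.
\<close>
lemma uniform_range:
  fixes \<Omega> :: "'d::finite config \<times> 'd config \<Rightarrow> real"
  assumes inv: "shift_invariant \<Omega>" and comp: "components \<Omega> \<omega>"
    and loc: "\<forall>e\<in>lattice_edges. \<omega> e \<in> C_loc"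
  obtains R :: int where "1 \<le> R"
    "\<And>p q A B. (p, q) \<in> lattice_edges \<Longrightarrow> finite A \<Longrightarrow> finite B \<Longrightarrow>
      (\<And>x. (\<forall>i. \<bar>x $ i - p $ i\<bar> \<le> R) \<Longrightarrow> x \<in> A \<longleftrightarrow> x \<in> B) \<Longrightarrow>
      \<Omega> ((\<lambda>x. x \<in> A), (\<lambda>x. x \<in> transpose p q ` A)) =
      \<Omega> ((\<lambda>x. x \<in> B), (\<lambda>x. x \<in> transpose p q ` B))"
proof -
  define E where "E = {q :: 'd site. (0, q) \<in> lattice_edges}"
  define supp where "supp q \<Lambda> \<longleftrightarrow> finite \<Lambda> \<and>
      (\<forall>\<eta> \<eta>'. (\<forall>x\<in>\<Lambda>. \<eta> x = \<eta>' x) \<longrightarrow> \<omega> (0, q) \<eta> = \<omega> (0, q) \<eta>')" for q \<Lambda>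
  have "\<exists>\<Lambda>. supp q \<Lambda>" if "q \<in> E" for q
  proof -
    have "\<omega> (0, q) \<in> C_loc" using loc that by (simp add: E_def)
    then show ?thesis unfolding C_loc_def mem_Collect_eq supp_def .
  qed
  then obtain \<Lambda> where supp: "\<And>q. q \<in> E \<Longrightarrow> supp q (\<Lambda> q)" by metis
  then have fin: "\<And>q. q \<in> E \<Longrightarrow> finite (\<Lambda> q)" by (simp add: supp_def)
  define S where "S = insert 1 (\<Union>q\<in>E. \<Union>x\<in>\<Lambda> q. range (\<lambda>i. \<bar>x $ i\<bar>))"
  define R where "R = Max S"
  have "finite E" unfolding E_def by (rule finite_edges_at_origin)
  with fin have S: "finite S" by (simp add: S_def)
  have R1: "1 \<le> R" unfolding R_def using S by (rule Max_ge) (simp add: S_def)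
  have R: "\<bar>x $ i\<bar> \<le> R" if "q \<in> E" "x \<in> \<Lambda> q" for q x i
    unfolding R_def using S by (rule Max_ge) (use that in \<open>auto simp: S_def\<close>)
  show ?thesis
  proof (rule that[OF R1])
    fix p q :: "'d site" and A B :: "'d site set"
    assume e: "(p, q) \<in> lattice_edges" and A: "finite A" and B: "finite B"
      and AB: "\<And>x. (\<forall>i. \<bar>x $ i - p $ i\<bar> \<le> R) \<Longrightarrow> x \<in> A \<longleftrightarrow> x \<in> B"
    have qE: "q - p \<in> E" using e lattice_edges_shift[of p 0 "q - p"] by (simp add: E_def)
    then have e0: "(0, q - p) \<in> lattice_edges" by (simp add: E_def)
    have to_origin: "\<Omega> ((\<lambda>x. x \<in> A), (\<lambda>x. x \<in> transpose p q ` A)) =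
        \<omega> (0, q - p) (\<lambda>x. x \<in> (+) (- p) ` A)" if "finite A" for A
    proof -
      have "\<omega> (0, q - p) (\<lambda>x. x \<in> (+) (- p) ` A) =
          \<Omega> ((\<lambda>x. x \<in> (+) (- p) ` A), (\<lambda>x. x \<in> transpose 0 (q - p) ` (+) (- p) ` A))"
        using comp e0 that mem_fin_configs_iff[of "(+) (- p) ` A"]
          exchange_mem[of 0 "q - p" "(+) (- p) ` A"]
        by (simp add: components_def)
      also have "\<dots> = \<Omega> ((\<lambda>x. x \<in> (+) (- p) ` A), (\<lambda>x. x \<in> (+) (- p) ` transpose p q ` A))"
        unfolding shift_transpose_image by simp
      also have "\<dots> = \<Omega> ((\<lambda>x. x \<in> A), (\<lambda>x. x \<in> transpose p q ` A))"
        by (rule shift_invariant_mem[OF inv e that])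
      finally show ?thesis by simp
    qed
    from supp[OF qE] have eq: "\<omega> (0, q - p) \<eta> = \<omega> (0, q - p) \<zeta>"
      if "\<And>x. x \<in> \<Lambda> (q - p) \<Longrightarrow> \<eta> x = \<zeta> x" for \<eta> \<zeta>
      using that by (simp add: supp_def)
    have agree: "x \<in> (+) (- p) ` A \<longleftrightarrow> x \<in> (+) (- p) ` B" if "x \<in> \<Lambda> (q - p)" for x
    proof -
      have "p + x \<in> A \<longleftrightarrow> p + x \<in> B" using R[OF qE that] by (intro AB) simp
      moreover have "x \<in> (+) (- p) ` C \<longleftrightarrow> p + x \<in> C" for C
        by (force simp: image_iff algebra_simps)
      ultimately show ?thesis by simp
    qed
    show "\<Omega> ((\<lambda>x. x \<in> A), (\<lambda>x. x \<in> transpose p q ` A)) =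
        \<Omega> ((\<lambda>x. x \<in> B), (\<lambda>x. x \<in> transpose p q ` B))"
      unfolding to_origin[OF A] to_origin[OF B] by (rule eq) (rule agree)
  qed
qed

section \<open>The density of a local potential\<close>

lemma additive_site:
  fixes h :: "'d::finite site \<Rightarrow> real"
  assumes add: "\<And>x y. h (x + y) = h x + h y"
  shows "h x = (\<Sum>j\<in>UNIV. h (axis j 1) * real_of_int (x $ j))"
proof -
  have zero: "h 0 = 0" using add[of 0 0] by simp
  have minus: "h (- y) = - h y" for y using add[of y "- y"] zero by simp
  have sum_h: "h (\<Sum>j\<in>S. g j) = (\<Sum>j\<in>S. h (g j))" if "finite S" for S :: "'d set" and g
    using that by induction (simp_all add: zero add)
  have nat: "h (axis j (int n)) = h (axis j 1) * real n" for j n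
  proof (induction n)
    case 0
    have "h (axis j 0) = 0" by (metis axis_eq_0_iff zero)
    then show ?case by simp
  next
    case (Suc n)
    have "axis j (int (Suc n)) = axis j (int n) + (axis j 1 :: 'd site)"
      by (simp add: axis_def vec_eq_iff)
    then show ?case using Suc by (simp add: add algebra_simps)
  qed
  have int: "h (axis j k) = h (axis j 1) * real_of_int k" for j k
  proof (cases "0 \<le> k")
    case True
    then show ?thesis using nat[of j "nat k"] by simp
  next
    case False
    have "axis j k = - (axis j (- k) :: 'd site)" by (simp add: axis_def vec_eq_iff)
    then show ?thesis using nat[of j "nat (- k)"] False by (simp add: minus)
  qed
  have "(\<Sum>j\<in>UNIV. axis j (x $ j)) = x" by (simp add: vec_eq_iff axis_def)
  then have "h x = h (\<Sum>j\<in>UNIV. axis j (x $ j))" by (simp only:)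
  also have "\<dots> = (\<Sum>j\<in>UNIV. h (axis j (x $ j)))" by (rule sum_h) simp
  also have "\<dots> = (\<Sum>j\<in>UNIV. h (axis j 1) * real_of_int (x $ j))"
    by (rule sum.cong[OF refl]) (rule int)
  finally show ?thesis .
qed

lemma moment_mem:
  assumes "finite A"
  shows "moment j (\<lambda>x. x \<in> A) = (\<Sum>x\<in>A. real_of_int (x $ j))"
proof -
  have "moment j (\<lambda>x. x \<in> A) = (\<Sum>x\<in>A. real_of_int (x $ j) * occupation x (\<lambda>x. x \<in> A))"
    unfolding moment_def by (rule Sum_any.expand_superset) (auto simp: assms occupation_def)
  then show ?thesis by (simp add: occupation_def)
qed

context local_potential
begin

text \<open>
  The share of the origin in the interactions of all clusters containing it. Clusters that
  leave the box of radius \<open>R\<close> are left out to make the sum local; they are wide, so that their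
  interaction is zero.
\<close>
definition density :: "'d config \<Rightarrow> real" where
  "density \<eta> = (\<Sum>B | B \<subseteq> {x. (\<forall>i. \<bar>x $ i\<bar> \<le> R) \<and> \<eta> x} \<and> 0 \<in> B. interaction B / real (card B))"

lemma density_C_loc: "density \<in> C_loc"
proof -
  have "density \<eta> = density \<zeta>" if "\<forall>x\<in>{x. \<forall>i. \<bar>x $ i\<bar> \<le> R}. \<eta> x = \<zeta> x" for \<eta> \<zeta>
  proof -
    have "{x. (\<forall>i. \<bar>x $ i\<bar> \<le> R) \<and> \<eta> x} = {x. (\<forall>i. \<bar>x $ i\<bar> \<le> R) \<and> \<zeta> x}" using that by auto
    then show ?thesis by (simp add: density_def)
  qed
  with finite_box show ?thesis unfolding C_loc_def by blast
qed

lemma density_star: "density star = 0"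
proof -
  have "{B. B \<subseteq> {} \<and> 0 \<in> B} = {}" by auto
  then show ?thesis by (simp add: density_def star_def)
qed

lemma density_mem:
  assumes "finite A"
  shows "density (\<lambda>x. x \<in> A) = (\<Sum>B\<in>{B \<in> Pow A. 0 \<in> B}. interaction B / real (card B))"
  unfolding density_def
proof (rule sum.mono_neutral_left)
  show "\<forall>B\<in>{B \<in> Pow A. 0 \<in> B} - {B. B \<subseteq> {x. (\<forall>i. \<bar>x $ i\<bar> \<le> R) \<and> x \<in> A} \<and> 0 \<in> B}.
      interaction B / real (card B) = 0"
  proof
    fix B assume B: "B \<in> {B \<in> Pow A. 0 \<in> B} - {B. B \<subseteq> {x. (\<forall>i. \<bar>x $ i\<bar> \<le> R) \<and> x \<in> A} \<and> 0 \<in> B}"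
    then obtain x i where x: "x \<in> B" "\<not> \<bar>x $ i\<bar> \<le> R" by blast
    from B have "0 \<in> B" by simp
    have "0 $ i + R < x $ i \<or> x $ i + R < 0 $ i" using x(2) by auto
    with x(1) \<open>0 \<in> B\<close> have "wide B" unfolding wide_def by blast
    moreover have "finite B" using B assms by (auto intro: finite_subset)
    ultimately show "interaction B / real (card B) = 0" by (simp add: interaction_wide)
  qed
qed (use assms in auto)

lemma shift_density_mem:
  assumes "finite A"
  shows "shift_fun x density (\<lambda>y. y \<in> A) = (\<Sum>B\<in>{B \<in> Pow A. x \<in> B}. interaction B / real (card B))"
proof -
  have "shift_fun x density (\<lambda>y. y \<in> A) =
      (\<Sum>B\<in>{B \<in> Pow ((+) (- x) ` A). 0 \<in> B}. interaction B / real (card B))"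
    using assms by (simp only: shift_fun_def shift_config_mem density_mem finite_imageI)
  also have "\<dots> = (\<Sum>B\<in>{B \<in> Pow A. x \<in> B}. interaction B / real (card B))"
  proof (rule sum.reindex_bij_witness[of _ "(`) ((+) (- x))" "(`) ((+) x)"])
    fix B assume B: "B \<in> {B \<in> Pow ((+) (- x) ` A). 0 \<in> B}"
    then have "(+) x ` B \<subseteq> (+) x ` (+) (- x) ` A" by blast
    with B show "(+) x ` B \<in> {B \<in> Pow A. x \<in> B}" by (force simp: image_comp comp_def)
    have "finite B" using B assms by (auto intro: finite_subset)
    then show "interaction ((+) x ` B) / real (card ((+) x ` B)) = interaction B / real (card B)"
      by (simp add: interaction_shift card_image)
  qed (force simp: image_comp comp_def)+
  finally show ?thesis .
qed

text \<open>
  Double counting: every cluster \<open>B\<close> occurs once for each of its \<open>card B\<close> sites.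
\<close>
lemma shift_sum_density:
  assumes A: "finite A"
  shows "shift_sum density (\<lambda>x. x \<in> A) = (\<Sum>B\<in>Pow A. interaction B)"
proof -
  have "shift_sum density (\<lambda>x. x \<in> A) = (\<Sum>x\<in>A. shift_fun x density (\<lambda>x. x \<in> A))"
    unfolding shift_sum_def
  proof (rule Sum_any.expand_superset[OF A], rule subsetI, rule ccontr)
    fix x assume x: "x \<in> {x. shift_fun x density (\<lambda>x. x \<in> A) \<noteq> 0}" "x \<notin> A"
    then have "{B \<in> Pow A. x \<in> B} = {}" by blast
    then have "shift_fun x density (\<lambda>x. x \<in> A) = 0"
      unfolding shift_density_mem[OF A] by (simp only: sum.empty)
    with x(1) show False by simp
  qed
  also have "\<dots> = (\<Sum>x\<in>A. \<Sum>B\<in>{B \<in> Pow A. x \<in> B}. interaction B / real (card B))"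
    by (simp add: shift_density_mem[OF A])
  also have "\<dots> = (\<Sum>B\<in>Pow A. \<Sum>x\<in>{x \<in> A. x \<in> B}. interaction B / real (card B))"
    using A by (intro sum.swap_restrict) auto
  also have "\<dots> = (\<Sum>B\<in>Pow A. interaction B)"
  proof (rule sum.cong[OF refl])
    fix B assume "B \<in> Pow A"
    then have "{x \<in> A. x \<in> B} = B" "finite B" using A by (auto intro: finite_subset)
    then show "(\<Sum>x\<in>{x \<in> A. x \<in> B}. interaction B / real (card B)) = interaction B"
      by (cases "B = {}") (simp_all add: interaction_empty)
  qed
  finally show ?thesis .
qed

lemma sum_slope:
  assumes "finite A"
  shows "(\<Sum>x\<in>A. slope x) = (\<Sum>j\<in>UNIV. slope (axis j 1) * moment j (\<lambda>x. x \<in> A))"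
proof -
  have "(\<Sum>x\<in>A. slope x) = (\<Sum>x\<in>A. \<Sum>j\<in>UNIV. slope (axis j 1) * real_of_int (x $ j))"
    by (rule sum.cong[OF refl], rule additive_site, rule slope_add)
  also have "\<dots> = (\<Sum>j\<in>UNIV. \<Sum>x\<in>A. slope (axis j 1) * real_of_int (x $ j))" by (rule sum.swap)
  finally show ?thesis by (simp add: moment_mem[OF assms] sum_distrib_left)
qed

end

section \<open>Decomposition of shift-invariant closed forms\<close>

theorem theorem4:
  fixes \<Omega> :: "'d::finite config \<times> 'd config \<Rightarrow> real"
    and \<omega> :: "'d edge \<Rightarrow> 'd config \<Rightarrow> real"
  assumes "closed_form \<Omega>"
    and "shift_invariant \<Omega>"
    and "components \<Omega> \<omega>"
    and "\<forall>e\<in>lattice_edges. \<omega> e \<in> C_loc"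
  shows "\<exists>(a :: 'd \<Rightarrow> real) f. f \<in> C_loc \<and> f star = 0 \<and>
    (\<forall>e\<in>lattice_edges. \<forall>\<eta>\<in>fin_configs.
       \<omega> e \<eta> = grad e (\<lambda>\<zeta>. shift_sum f \<zeta> + (\<Sum>j\<in>UNIV. a j * moment j \<zeta>)) \<eta>)"
proof -
  obtain F where F: "\<And>\<eta> \<zeta>. (\<eta>, \<zeta>) \<in> transitions \<Longrightarrow> \<Omega> (\<eta>, \<zeta>) = F \<zeta> - F \<eta>"
    using closed_form_potential[OF assms(1)] by blast
  obtain R :: int where R: "1 \<le> R"
    and range: "\<And>p q A B. (p, q) \<in> lattice_edges \<Longrightarrow> finite A \<Longrightarrow> finite B \<Longrightarrow>
      (\<And>x. (\<forall>i. \<bar>x $ i - p $ i\<bar> \<le> R) \<Longrightarrow> x \<in> A \<longleftrightarrow> x \<in> B) \<Longrightarrow>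
      \<Omega> ((\<lambda>x. x \<in> A), (\<lambda>x. x \<in> transpose p q ` A)) =
      \<Omega> ((\<lambda>x. x \<in> B), (\<lambda>x. x \<in> transpose p q ` B))"
    using uniform_range[OF assms(2-4)] by blast
  define U where "U A = F (\<lambda>x. x \<in> A)" for A
  have \<Omega>: "\<Omega> ((\<lambda>x. x \<in> A), (\<lambda>x. x \<in> transpose p q ` A)) = U (transpose p q ` A) - U A"
    if "(p, q) \<in> lattice_edges" "finite A" for p q A
    unfolding U_def by (rule F[OF transition_mem[OF that]])
  interpret local_potential U R
  proof
    fix p q :: "'d site" and A B :: "'d site set"
    assume *: "(p, q) \<in> lattice_edges" "finite A" "finite B"
      "\<And>x. (\<forall>i. \<bar>x $ i - p $ i\<bar> \<le> R) \<Longrightarrow> x \<in> A \<longleftrightarrow> x \<in> B"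
    show "U (transpose p q ` A) - U A = U (transpose p q ` B) - U B"
      unfolding \<Omega>[OF *(1,2), symmetric] \<Omega>[OF *(1,3), symmetric]
      by (rule range[OF *(1-3)]) (rule *(4))
  next
    fix p q v :: "'d site" and A :: "'d site set"
    assume *: "(p, q) \<in> lattice_edges" "finite A"
    have e: "(v + p, v + q) \<in> lattice_edges" using *(1) by (simp only: lattice_edges_shift)
    show "U ((+) v ` transpose p q ` A) - U ((+) v ` A) = U (transpose p q ` A) - U A"
      using shift_invariant_mem[OF assms(2) *, of v] \<Omega>[OF *] \<Omega>[OF e finite_imageI[OF *(2)], of "(+) v"]
      unfolding shift_transpose_image by simp
  qed (rule R)
  have "\<omega> e \<eta> = grad e (\<lambda>\<zeta>. shift_sum density \<zeta> + (\<Sum>j\<in>UNIV. slope (axis j 1) * moment j \<zeta>)) \<eta>"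
    if e: "e \<in> lattice_edges" and \<eta>: "\<eta> \<in> fin_configs" for e \<eta>
  proof -
    obtain p q where pq: "e = (p, q)" by (cases e)
    define A where "A = {x. \<eta> x}"
    have \<eta>A: "\<eta> = (\<lambda>x. x \<in> A)" by (simp add: A_def)
    with \<eta> have A: "finite A" by (simp add: mem_fin_configs_iff)
    have "\<omega> e \<eta> = \<Omega> (\<eta>, exchange e \<eta>)" using assms(3) e \<eta> by (simp add: components_def)
    also have "\<dots> = U (transpose p q ` A) - U A"
      unfolding \<eta>A pq exchange_mem using e A by (intro \<Omega>) (simp_all add: pq)
    finally show ?thesis
      using A unfolding gradient_decomposition[OF A] grad_def \<eta>A pq exchange_mem
      by (simp add: shift_sum_density sum_slope)
  qed
  then show ?thesis
    by (intro exI[of _ "\<lambda>j. slope (axis j 1)"] exI[of _ density] conjI ballI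
      density_C_loc density_star)
qed

end
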